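(* For every integer $k\ge 154$, the minimum Lee weight of every self-dual $\mathbb{Z}_4$-code of length $24k$ is at most $8k$.
   Context: A $\mathbb{Z}_4$-code of length $n$ is a $\mathbb{Z}_4$-submodule $\mathcal{C}$ of $\mathbb{Z}_4^n$, where $\mathbb{Z}_4=\{0,1,2,3\}$ is the ring of integers modulo $4$. Its dual is $\mathcal{C}^\perp=\{x\in\mathbb{Z}_4^n \mid x\cdot y=0 \text{ for all } y\in\mathcal{C}\}$, with $x\cdot y$ the standard inner product; $\mathcal{C}$ is self-dual if $\mathcal{C}=\mathcal{C}^\perp$. For $x\in\mathbb{Z}_4^n$ let $n_i(x)$ be the number of components of $x$ equal to $i$. The Lee weight of $x$ is $n_1(x)+2n_2(x)+n_3(x)$, and the minimum Lee weight of $\mathcal{C}$ is the smallest Lee weight among all non-zero codewords of $\mathcal{C}$. *)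

theory Defs
  imports "HOL-Analysis.Finite_Cartesian_Product"
begin

text \<open>
  The numeral type \<open>4\<close> carries arithmetic modulo \<open>4\<close>. Coordinates are indexed by a finite type
  \<open>'n\<close>, so the length of a code is \<open>CARD('n)\<close>.
\<close>

type_synonym z4 = 4

text \<open>Validates the use of the locale predicate \<open>module.subspace\<close> below.\<close>

lemma module_z4_vec: "module ((*s) :: z4 \<Rightarrow> z4 ^ 'n \<Rightarrow> z4 ^ 'n)"
  by unfold_locales (simp_all add: vec_eq_iff algebra_simps)

definition z4_code :: "(z4 ^ 'n) set \<Rightarrow> bool" where
  "z4_code C \<longleftrightarrow> module.subspace (*s) C"

definition z4_dual :: "(z4 ^ 'n) set \<Rightarrow> (z4 ^ 'n) set" where
  "z4_dual C = {x. \<forall>y\<in>C. scalar_product x y = 0}"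

definition z4_self_dual :: "(z4 ^ 'n) set \<Rightarrow> bool" where
  "z4_self_dual C \<longleftrightarrow> z4_code C \<and> C = z4_dual C"

definition comp_count :: "z4 \<Rightarrow> z4 ^ 'n \<Rightarrow> nat" where
  "comp_count i x = card {j. x $ j = i}"

definition lee_weight :: "z4 ^ 'n \<Rightarrow> nat" where
  "lee_weight x = comp_count 1 x + 2 * comp_count 2 x + comp_count 3 x"

text \<open>Unspecified for the zero code, which is never self-dual because \<open>CARD('n) > 0\<close>.\<close>

definition min_lee_weight :: "(z4 ^ 'n) set \<Rightarrow> nat" where
  "min_lee_weight C = Min (lee_weight ` (C - {0}))"

end

theory Submission
  imports Defs Complex_Main "HOL-Computational_Algebra.Polynomial_FPS"
begin

text \<open>
  The supports of the odd entries of codewords form a doubly even binary code \<open>B\<close>, and doubling a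
  binary word \<open>v\<close> gives a codeword of Lee weight \<open>2 wt(v)\<close> exactly when \<open>v\<close> lies in the dual of \<open>B\<close>.
  As \<open>8\<close> divides the length, \<open>B\<close> extends to a doubly even self-dual binary code \<open>D\<close>, which is
  contained in the dual of \<open>B\<close>. So it suffices that \<open>D\<close> has a nonzero word of weight at most \<open>4k\<close>.
  Otherwise Gleason's theorem determines the weight enumerator of \<open>D\<close>, and Lagrange inversion gives
  the number of words of weight \<open>4k + 8\<close> as a positive factor times a polynomial in \<open>k\<close> that is
  negative for \<open>k \<ge> 154\<close> (Mallows--Odlyzko--Sloane, Zhang).
\<close>

subsection \<open>Doubly even binary codes\<close>

text \<open>A binary word is identified with its support, so that addition becomes symmetric difference
and the inner product of two words is the parity of their intersection.\<close>

definition binary_code :: "'n set set \<Rightarrow> bool" where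
  "binary_code D \<longleftrightarrow> {} \<in> D \<and> (\<forall>A\<in>D. \<forall>B\<in>D. sym_diff A B \<in> D)"

definition binary_dual :: "'n set set \<Rightarrow> 'n set set" where
  "binary_dual D = {X. \<forall>A\<in>D. even (card (A \<inter> X))}"

definition doubly_even :: "'n set set \<Rightarrow> bool" where
  "doubly_even D \<longleftrightarrow> (\<forall>A\<in>D. 4 dvd card A)"

lemma binary_codeI:
  "{} \<in> D \<Longrightarrow> (\<And>A B. A \<in> D \<Longrightarrow> B \<in> D \<Longrightarrow> sym_diff A B \<in> D) \<Longrightarrow> binary_code D"
  by (simp add: binary_code_def)

lemma card_sym_diff:
  assumes "finite A" "finite B"
  shows "card (sym_diff A B) + 2 * card (A \<inter> B) = card A + card B"
proof -
  have "card A = card (A - B) + card (A \<inter> B)"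
    by (metis assms(1) card_Diff_subset_Int card_mono finite_Int inf_le1 le_add_diff_inverse2)
  moreover have "card B = card (B - A) + card (A \<inter> B)"
    by (metis assms(2) card_Diff_subset_Int card_mono finite_Int inf_le1 le_add_diff_inverse2 inf_commute)
  moreover have "card (sym_diff A B) = card (A - B) + card (B - A)"
    by (rule card_Un_disjoint) (use assms in auto)
  ultimately show ?thesis by simp
qed

lemma even_card_sym_diff:
  assumes "finite A" "finite B"
  shows "even (card (sym_diff A B)) \<longleftrightarrow> even (card A + card B)"
  using card_sym_diff[OF assms] by (metis even_add even_mult_iff even_numeral)

lemma even_card_sym_diff_Int:
  fixes A B X :: "'n::finite set"
  shows "even (card (sym_diff A B \<inter> X)) \<longleftrightarrow> even (card (A \<inter> X) + card (B \<inter> X))"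
proof -
  have "sym_diff A B \<inter> X = sym_diff (A \<inter> X) (B \<inter> X)" by auto
  then show ?thesis by (simp only: even_card_sym_diff[OF finite finite])
qed

section \<open>Characters and the MacWilliams identity\<close>

lemma sym_diff_involutive: "sym_diff (sym_diff A B) B = A"
  by auto

lemma bij_betw_sym_diff:
  assumes "binary_code D" "B \<in> D"
  shows "bij_betw (\<lambda>A. sym_diff A B) D D"
  by (rule bij_betw_byWitness[where f' = "\<lambda>A. sym_diff A B"])
    (use assms in \<open>auto simp: binary_code_def sym_diff_involutive\<close>)

text \<open>Orthogonality of characters: if some \<open>B\<close> in \<open>D\<close> meets
  \<open>X\<close> in an odd set, translation by \<open>B\<close> permutes \<open>D\<close> and
  flips every sign, so the sum equals its own negative.\<close>

lemma sum_character:
  fixes D :: "'n::finite set set"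
  assumes "binary_code D"
  shows "(\<Sum>A\<in>D. (-1) ^ card (A \<inter> X)) =
    (if X \<in> binary_dual D then of_nat (card D) else 0 :: 'a::field_char_0)"
proof (cases "X \<in> binary_dual D")
  case True
  then have "(\<Sum>A\<in>D. (-1) ^ card (A \<inter> X)) = (\<Sum>A\<in>D. 1 :: 'a)"
    by (intro sum.cong) (auto simp: binary_dual_def)
  with True show ?thesis by simp
next
  case False
  then obtain B where B: "B \<in> D" "odd (card (B \<inter> X))" by (auto simp: binary_dual_def)
  have "(\<Sum>A\<in>D. (-1) ^ card (A \<inter> X)) = (\<Sum>A\<in>D. (-1 :: 'a) ^ card (sym_diff A B \<inter> X))"
    by (rule sum.reindex_bij_betw[OF bij_betw_sym_diff[OF assms B(1)], symmetric])
  also have "\<dots> = (\<Sum>A\<in>D. - ((-1) ^ card (A \<inter> X)))"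
  proof (rule sum.cong)
    fix A
    show "(-1 :: 'a) ^ card (sym_diff A B \<inter> X) = - ((-1) ^ card (A \<inter> X))"
      using even_card_sym_diff_Int[of A B X] B(2)
      by (cases "even (card (A \<inter> X))"; cases "even (card (sym_diff A B \<inter> X))") auto
  qed simp
  finally have "(\<Sum>A\<in>D. (-1) ^ card (A \<inter> X)) = - (\<Sum>A\<in>D. (-1 :: 'a) ^ card (A \<inter> X))"
    by (simp add: sum_negf)
  with False show ?thesis by (simp add: eq_neg_iff_add_eq_0 mult_2[symmetric])
qed

text \<open>Each product on the right expands over all words \<open>X\<close> into a character value
  times \<open>y ^ card X\<close>. After the sums are swapped, character orthogonality keeps only
  the dual words.\<close>

theorem MacWilliams:
  fixes D :: "'n::finite set set" and y :: "'a::field_char_0"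
  assumes "binary_code D"
  shows "of_nat (card D) * (\<Sum>X\<in>binary_dual D. y ^ card X) =
    (\<Sum>A\<in>D. (1 - y) ^ card A * (1 + y) ^ (CARD('n) - card A))"
proof -
  have expand: "(1 - y) ^ card A * (1 + y) ^ (CARD('n) - card A) =
      (\<Sum>X\<in>UNIV. (-1) ^ card (A \<inter> X) * y ^ card X)" for A :: "'n set"
  proof -
    \<comment> \<open>A sign for each coordinate in \<open>A\<close>, so that the product of
      \<open>?c i + 1\<close> over all coordinates expands as a sum over subsets.\<close>
    let ?c = "\<lambda>i. if i \<in> A then - y else y"
    have "(1 - y) ^ card A * (1 + y) ^ (CARD('n) - card A) = (\<Prod>i\<in>A. ?c i + 1) * (\<Prod>i\<in>-A. ?c i + 1)"
      by (simp add: Compl_eq_Diff_UNIV card_Diff_subset add.commute)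
    also have "\<dots> = (\<Prod>i\<in>A \<union> -A. ?c i + 1)"
      by (rule prod.union_disjoint[symmetric]) auto
    also have "\<dots> = (\<Sum>X\<in>UNIV. \<Prod>i\<in>X. ?c i)"
      by (simp add: prod_add)
    also have "\<dots> = (\<Sum>X\<in>UNIV. (-1) ^ card (A \<inter> X) * y ^ card X)"
    proof (rule sum.cong)
      fix X :: "'n set"
      have "(\<Prod>i\<in>X. ?c i) = (\<Prod>i\<in>X. (if i \<in> A then - 1 else 1) * y)"
        by (intro prod.cong) auto
      also have "\<dots> = (-1) ^ card (A \<inter> X) * y ^ card X"
        by (simp add: prod.distrib prod.If_cases Int_commute)
      finally show "(\<Prod>i\<in>X. ?c i) = (-1) ^ card (A \<inter> X) * y ^ card X" .
    qed simp
    finally show ?thesis .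
  qed
  have "(\<Sum>A\<in>D. (1 - y) ^ card A * (1 + y) ^ (CARD('n) - card A)) =
      (\<Sum>X\<in>UNIV. \<Sum>A\<in>D. (-1) ^ card (A \<inter> X) * y ^ card X)"
    unfolding expand by (rule sum.swap)
  also have "\<dots> = (\<Sum>X\<in>UNIV. if X \<in> binary_dual D then of_nat (card D) * y ^ card X else 0)"
    by (intro sum.cong) (auto simp: sum_distrib_right[symmetric] sum_character[OF assms])
  also have "\<dots> = of_nat (card D) * (\<Sum>X\<in>binary_dual D. y ^ card X)"
    by (simp add: sum.If_cases sum_distrib_left)
  finally show ?thesis by simp
qed

text \<open>In \<open>card (sym_diff A X) + 2 * card (A \<inter> X) = card A + card X\<close> every
  term but the second is known to be divisible by 4.\<close>

lemma doubly_even_self_orthogonal: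
  fixes D :: "'n::finite set set"
  assumes "binary_code D" "doubly_even D"
  shows "D \<subseteq> binary_dual D"
proof
  fix X assume X: "X \<in> D"
  have "even (card (A \<inter> X))" if A: "A \<in> D" for A
  proof -
    have "4 dvd card (sym_diff A X)" "4 dvd card A" "4 dvd card X"
      using assms A X by (auto simp: binary_code_def doubly_even_def)
    with card_sym_diff[of A X] have "4 dvd 2 * card (A \<inter> X)"
      by (metis dvd_add dvd_add_right_iff finite)
    then show ?thesis by presburger
  qed
  then show "X \<in> binary_dual D" by (auto simp: binary_dual_def)
qed

section \<open>Duals and maximal doubly even codes\<close>

lemma binary_dual_antimono: "D \<subseteq> E \<Longrightarrow> binary_dual E \<subseteq> binary_dual D"
  by (auto simp: binary_dual_def)

lemma binary_code_dual: "binary_code (binary_dual (D :: 'n::finite set set))"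
proof -
  have "even (card (Z \<inter> sym_diff A B)) \<longleftrightarrow> even (card (Z \<inter> A) + card (Z \<inter> B))" for A B Z :: "'n set"
    by (metis even_card_sym_diff_Int inf_commute)
  then show ?thesis by (simp add: binary_code_def binary_dual_def)
qed

text \<open>The union of two cosets is the code spanned by \<open>D\<close> and \<open>X\<close>.
  Weights in the new coset stay divisible by 4 because the overlaps with \<open>X\<close> are even
  and are counted twice.\<close>

lemma doubly_even_adjoin:
  fixes D :: "'n::finite set set"
  assumes D: "binary_code D" "doubly_even D" and X: "X \<in> binary_dual D" "4 dvd card X"
  shows "binary_code (D \<union> (\<lambda>A. sym_diff A X) ` D)" "doubly_even (D \<union> (\<lambda>A. sym_diff A X) ` D)"
proof -
  have mem: "A \<in> D \<union> (\<lambda>A. sym_diff A X) ` D \<longleftrightarrow> A \<in> D \<or> sym_diff A X \<in> D" for A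
    using sym_diff_involutive[of _ X] by (auto simp: image_iff)
  have sd: "sym_diff A B \<in> D" if "A \<in> D" "B \<in> D" for A B
    using D that by (auto simp: binary_code_def)
  have "sym_diff A B \<in> D \<or> sym_diff (sym_diff A B) X \<in> D"
    if "A \<in> D \<or> sym_diff A X \<in> D" "B \<in> D \<or> sym_diff B X \<in> D" for A B
  proof -
    have "sym_diff (sym_diff A X) B = sym_diff (sym_diff A B) X"
      "sym_diff A (sym_diff B X) = sym_diff (sym_diff A B) X"
      "sym_diff (sym_diff A X) (sym_diff B X) = sym_diff A B" by auto
    with that show ?thesis using sd by metis
  qed
  moreover have "{} \<in> D" using D by (simp add: binary_code_def)
  ultimately show "binary_code (D \<union> (\<lambda>A. sym_diff A X) ` D)"
    by (intro binary_codeI) (simp_all only: mem simp_thms)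
  have "4 dvd card (sym_diff A X)" if "A \<in> D" for A
  proof -
    have "even (card (A \<inter> X))" "4 dvd card A"
      using that X D by (auto simp: binary_dual_def doubly_even_def)
    then have "4 dvd card (sym_diff A X) + 2 * card (A \<inter> X)" "4 dvd 2 * card (A \<inter> X)"
      using X card_sym_diff[of A X] by (auto intro: dvd_add)
    then show ?thesis by (metis dvd_add_left_iff)
  qed
  then show "doubly_even (D \<union> (\<lambda>A. sym_diff A X) ` D)"
    using D by (auto simp: doubly_even_def)
qed

text \<open>Take a maximal doubly even \<open>D\<close>. Every word of \<open>binary_dual D\<close> outside \<open>D\<close> has weight
\<open>2\<close> modulo \<open>4\<close>, so evaluating the MacWilliams identity at \<open>\<i>\<close> shows that these words are
fewer than those of \<open>D\<close>; a proper subgroup has index at least \<open>2\<close>, hence there are none.\<close>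

theorem doubly_even_extension:
  fixes B :: "'n::finite set set"
  assumes B: "binary_code B" "doubly_even B" and n: "CARD('n) = 8 * m"
  obtains D where "B \<subseteq> D" "binary_code D" "doubly_even D" "binary_dual D = D" "card D = 16 ^ m"
proof -
  obtain D where "B \<subseteq> D" and D: "binary_code D" "doubly_even D"
    and max: "\<And>E. binary_code E \<Longrightarrow> doubly_even E \<Longrightarrow> D \<subseteq> E \<Longrightarrow> D = E"
    using finite_has_maximal2[of "{D. binary_code D \<and> doubly_even D}" B] B by auto
  have new: "X \<in> D" if "X \<in> binary_dual D" "4 dvd card X" for X
  proof -
    have "{} \<in> D" using D by (simp add: binary_code_def)
    then have "sym_diff {} X \<in> (\<lambda>A. sym_diff A X) ` D" by (rule imageI)
    then show ?thesis using max[OF doubly_even_adjoin[OF D that]] by auto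
  qed
  \<comment> \<open>The all-ones word has weight \<open>8 * m\<close> and is orthogonal to all even
    words; its presence in \<open>D\<close> forces all dual words to have even weight.\<close>
  have "UNIV \<in> D"
  proof (rule new)
    have "even (card A)" if "A \<in> D" for A
      using D(2) that dvd_trans[of 2 4 "card A"] by (auto simp: doubly_even_def)
    then show "UNIV \<in> binary_dual D" by (simp add: binary_dual_def)
    show "4 dvd CARD('n)" by (simp add: n)
  qed
  have even: "even (card X)" if "X \<in> binary_dual D" for X
    using that \<open>UNIV \<in> D\<close> by (auto simp: binary_dual_def)
  have sub: "D \<subseteq> binary_dual D" by (rule doubly_even_self_orthogonal[OF D])
  have pos: "card D > 0" using D by (auto simp: binary_code_def card_gt_0_iff)
  \<comment> \<open>Both fourth powers agree, so at \<open>y = \<i>\<close> every word of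
    \<open>D\<close> contributes \<open>(-4) ^ (2 * m) = 16 ^ m\<close>.\<close>
  have i4: "(1 - \<i>) ^ 4 = - 4" "(1 + \<i>) ^ 4 = - 4"
    by (simp_all add: power4_eq_xxxx algebra_simps)
  have "(1 - \<i>) ^ card A * (1 + \<i>) ^ (CARD('n) - card A) = 16 ^ m" if A: "A \<in> D" for A
  proof -
    obtain a where a: "card A = 4 * a" using D A by (auto simp: doubly_even_def)
    have "card A \<le> CARD('n)" by (rule card_mono) auto
    then have m: "CARD('n) - card A = 4 * (2 * m - a)" "a + (2 * m - a) = 2 * m"
      using n a by auto
    have "(1 - \<i>) ^ card A * (1 + \<i>) ^ (CARD('n) - card A) = (- 4) ^ (a + (2 * m - a))"
      unfolding m(1) unfolding a power_mult i4 power_add by (rule refl)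
    then show ?thesis unfolding m(2) power_mult by simp
  qed
  then have "(\<Sum>A\<in>D. (1 - \<i>) ^ card A * (1 + \<i>) ^ (CARD('n) - card A)) = of_nat (card D) * 16 ^ m"
    by simp
  then have "(\<Sum>X\<in>binary_dual D. \<i> ^ card X) = 16 ^ m"
    using MacWilliams[OF D(1), of \<i>] pos by (auto simp: card_gt_0_iff)
  moreover have "(\<Sum>X\<in>binary_dual D. \<i> ^ card X) =
      (\<Sum>X\<in>D. \<i> ^ card X) + (\<Sum>X\<in>binary_dual D - D. \<i> ^ card X)"
    using sum.subset_diff[OF sub, of "\<lambda>X. \<i> ^ card X"] by (simp add: add.commute)
  moreover have "\<i> ^ card X = 1" if "X \<in> D" for X
  proof -
    obtain a where a: "card X = 4 * a" using D \<open>X \<in> D\<close> by (auto simp: doubly_even_def)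
    show ?thesis unfolding a power_mult by (simp add: power4_eq_xxxx)
  qed
  moreover have "\<i> ^ card X = - 1" if "X \<in> binary_dual D - D" for X
  proof -
    have "even (card X)" "\<not> 4 dvd card X" using even new that by auto
    then obtain a where a: "card X = 2 * a" "odd a" by (auto elim!: evenE)
    show ?thesis unfolding a(1) power_mult using a(2) by simp
  qed
  ultimately have "of_nat (card D) - of_nat (card (binary_dual D - D)) = (16 ^ m :: complex)"
    by simp
  then have "of_nat (card D) = (of_nat (16 ^ m + card (binary_dual D - D)) :: complex)"
    by (simp add: algebra_simps)
  then have card: "card D = 16 ^ m + card (binary_dual D - D)"
    by (simp only: of_nat_eq_iff)
  have "binary_dual D = D"
  proof (rule ccontr)
    assume "binary_dual D \<noteq> D"
    with sub obtain X where X: "X \<in> binary_dual D" "X \<notin> D" by auto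
    have "sym_diff A X \<in> binary_dual D - D" if "A \<in> D" for A
    proof -
      have "sym_diff (sym_diff A X) A = X" by auto
      then have "sym_diff A X \<notin> D" using X(2) D that by (metis binary_code_def)
      moreover have "sym_diff A X \<in> binary_dual D"
        using binary_code_dual[of D] X(1) sub that by (auto simp: binary_code_def)
      ultimately show ?thesis by simp
    qed
    moreover have "inj_on (\<lambda>A. sym_diff A X) D"
      by (rule inj_on_inverseI[where g = "\<lambda>A. sym_diff A X"]) (rule sym_diff_involutive)
    ultimately have "card D \<le> card (binary_dual D - D)"
      by (intro card_inj_on_le) auto
    with card show False by simp
  qed
  moreover from this card have "card D = 16 ^ m" by simp
  ultimately show ?thesis using that \<open>B \<subseteq> D\<close> D by blast
qed

subsection \<open>Gleason's theorem\<close>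

text \<open>A doubly even code of length \<open>24k\<close> has weight enumerator \<open>q(y^4)\<close> with \<open>deg q \<le> 6k\<close>.
In the variable \<open>z = y^4\<close>, \<open>gleason_f\<close> is the weight enumerator of the extended Hamming code and
\<open>gleason_g\<close> stands for \<open>x^4 y^4 (x^4 - y^4)^4\<close>.\<close>

definition gleason_f :: "real poly" where "gleason_f = [:1, 14, 1:]"
definition gleason_g :: "real poly" where "gleason_g = [:0, 1:] * [:1, -1:] ^ 4"

text \<open>The MacWilliams identity for a self-dual code of length \<open>24 * k\<close>, which has
  \<open>4096 ^ k\<close> words, with \<open>(1 + y) ^ (24 * k)\<close> factored out.\<close>

definition gleason_invariant :: "nat \<Rightarrow> real poly \<Rightarrow> bool" where
  "gleason_invariant k q \<longleftrightarrow> degree q \<le> 6 * k \<and>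
    (\<forall>y. y \<noteq> -1 \<longrightarrow> 4096 ^ k * poly q (y ^ 4) = (1 + y) ^ (24 * k) * poly q (((1 - y) / (1 + y)) ^ 4))"

lemma gleason_invariant_diff:
  "gleason_invariant k p \<Longrightarrow> gleason_invariant k q \<Longrightarrow> gleason_invariant k (p - q)"
  by (simp add: gleason_invariant_def degree_diff_le right_diff_distrib)

lemma gleason_invariant_sum_smult:
  assumes "\<And>r. r \<in> R \<Longrightarrow> gleason_invariant k (B r)"
  shows "gleason_invariant k (\<Sum>r\<in>R. smult (a r) (B r))"
  using assms
  by (induction R rule: infinite_finite_induct)
     (auto simp: gleason_invariant_def distrib_left mult.left_commute intro!: degree_add_le
       intro: order_trans[OF degree_smult_le])

text \<open>Permits checking identities at positive arguments only, where fourth roots exist and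
  \<open>1 + y\<close> is nonzero.\<close>

lemma poly_eqI_pos:
  fixes p q :: "real poly"
  assumes "\<And>x. x > 0 \<Longrightarrow> poly p x = poly q x"
  shows "p = q"
proof (rule ccontr)
  assume "p \<noteq> q"
  then have "finite {x. poly (p - q) x = 0}" by (intro poly_roots_finite) simp
  then have "finite {0 :: real <..}" by (rule finite_subset[rotated]) (use assms in auto)
  then show False by (simp add: infinite_Ioi)
qed

section \<open>Reciprocity and zeros of invariant polynomials\<close>

lemma poly_altdef_le:
  fixes p :: "'a::comm_semiring_1 poly"
  assumes "degree p \<le> n"
  shows "poly p x = (\<Sum>i\<le>n. coeff p i * x ^ i)"
  unfolding poly_altdef
  by (rule sum.mono_neutral_left) (use assms in \<open>auto simp: coeff_eq_0\<close>)

text \<open>Compare the invariance at \<open>y\<close> and at \<open>-y\<close>: the arguments on the right are reciprocal.\<close>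

lemma gleason_invariant_reciprocal:
  assumes E: "gleason_invariant k E" and "j \<le> 6 * k"
  shows "coeff E j = coeff E (6 * k - j)"
proof -
  \<comment> \<open>The reversal of \<open>E\<close> with respect to degree
    \<open>6 * k\<close>.\<close>
  define R where "R = (\<Sum>i\<le>6*k. monom (coeff E (6 * k - i)) i)"
  have "poly R z = poly E z" if "z > 0" for z
  proof -
    define w where "w = root 4 z"
    have w: "w > 0" "w ^ 4 = z" using that by (auto simp: w_def)
    \<comment> \<open>The map \<open>w \<mapsto> (1 - w) / (1 + w)\<close> is an involution, so the
      transformed argument of this \<open>y\<close> is \<open>w\<close>.\<close>
    define y where "y = (1 - w) / (1 + w)"
    have y: "1 + y = 2 / (1 + w)" "1 - y = 2 * w / (1 + w)"
      using w by (auto simp: y_def field_simps)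
    have ne: "y \<noteq> - 1" "- y \<noteq> - 1" using y w by auto
    have "(1 - y) / (1 + y) = w" "(1 + y) / (1 - y) = inverse w"
      unfolding y using w by (auto simp: divide_simps)
    then have "((1 - y) / (1 + y)) ^ 4 = z" "((1 + y) / (1 - y)) ^ 4 = inverse z"
      using w by (simp_all add: power_inverse)
    moreover have "4096 ^ k * poly E (y ^ 4) = (1 + y) ^ (24 * k) * poly E (((1 - y) / (1 + y)) ^ 4)"
      using E ne(1) by (simp add: gleason_invariant_def)
    moreover have "4096 ^ k * poly E (y ^ 4) = (1 - y) ^ (24 * k) * poly E (((1 + y) / (1 - y)) ^ 4)"
      using E ne(2) unfolding gleason_invariant_def by (elim conjE allE[of _ "- y"]) simp
    ultimately have "(1 + y) ^ (24 * k) * poly E z = (1 - y) ^ (24 * k) * poly E (inverse z)"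
      by simp
    moreover have "1 - y = w * (1 + y)" using y by simp
    ultimately have "poly E z = w ^ (24 * k) * poly E (inverse z)"
      using ne by (simp add: power_mult_distrib)
    also have "w ^ (24 * k) = z ^ (6 * k)"
      unfolding w(2)[symmetric] by (simp flip: power_mult)
    also have "z ^ (6 * k) * poly E (inverse z) = (\<Sum>i\<le>6*k. coeff E i * z ^ (6 * k - i))"
    proof -
      have "degree E \<le> 6 * k" using E by (simp add: gleason_invariant_def)
      from poly_altdef_le[OF this, of "inverse z"] show ?thesis
        using that by (simp add: sum_distrib_left power_diff power_inverse field_simps)
    qed
    also have "\<dots> = (\<Sum>i\<le>6*k. coeff E (6 * k - i) * z ^ i)"
      by (rule sum.reindex_bij_witness[of _ "\<lambda>i. 6 * k - i" "\<lambda>i. 6 * k - i"]) auto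
    also have "\<dots> = poly R z" by (simp add: R_def poly_sum poly_monom)
    finally show ?thesis ..
  qed
  then have "R = E" by (rule poly_eqI_pos)
  moreover have "coeff R j = coeff E (6 * k - j)"
    using assms(2) by (simp add: R_def coeff_sum)
  ultimately show ?thesis by simp
qed

text \<open>The number 1 is a simple root of \<open>x^n - 1\<close>: the cofactor \<open>S\<close>
  takes the value \<open>n\<close> there. Substituting \<open>x^n\<close> thus preserves the
  multiplicity of the root 1.\<close>

lemma order_pcompose_monom:
  fixes p :: "real poly"
  assumes "p \<noteq> 0" "n > 0"
  shows "order 1 (pcompose p (monom 1 n)) = order 1 p"
proof -
  obtain q where q: "p = [:- 1, 1:] ^ order 1 p * q" "\<not> [:- 1, 1:] dvd q"
    using order_decomp[OF assms(1)] by blast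
  define S :: "real poly" where "S = (\<Sum>i<n. monom 1 i)"
  have "pcompose [:- 1, 1:] (monom 1 n) = (monom 1 n - 1 :: real poly)"
    by (simp add: pcompose_pCons one_pCons)
  also have "\<dots> = [:- 1, 1:] * S"
  proof -
    have "[:0, 1:] - 1 = ([:- 1, 1:] :: real poly)" by (simp add: one_pCons)
    then show ?thesis
      using power_diff_1_eq[of "[:0, 1:] :: real poly" n] by (simp only: S_def monom_altdef smult_1_left)
  qed
  finally have 1: "pcompose [:- 1, 1:] (monom 1 n) = [:- 1, 1:] * S" .
  have S1: "poly S 1 = n" by (simp add: S_def poly_sum poly_monom)
  have q1: "poly (pcompose q (monom 1 n)) 1 \<noteq> 0"
    using q(2) by (simp add: poly_pcompose poly_monom dvd_iff_poly_eq_0)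
  have pow: "pcompose (r ^ m) (monom 1 n) = pcompose r (monom 1 n) ^ m" for r :: "real poly" and m
    by (induction m) (simp_all add: pcompose_1 pcompose_mult)
  define U where "U = S ^ order 1 p * pcompose q (monom 1 n)"
  have p: "pcompose p (monom 1 n) = [:- 1, 1:] ^ order 1 p * U"
    unfolding U_def by (subst q(1)) (simp only: pcompose_mult pow 1 power_mult_distrib mult.assoc)
  have U: "poly U 1 \<noteq> 0"
    unfolding U_def using q1 S1 assms(2) by simp
  then have ne: "[:- 1, 1:] ^ order 1 p * U \<noteq> 0" by auto
  show ?thesis
    unfolding p order_mult[OF ne] order_power_n_n order_0I[OF U] by (rule add_0_right)
qed

text \<open>A zero of order \<open>k + 1\<close> at \<open>0\<close> gives one of order \<open>4k + 4\<close> at \<open>1\<close> by invariance and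
lowers the degree by \<open>k + 1\<close> by reciprocity, which is too many zeros.\<close>

lemma gleason_invariant_eq_0:
  assumes E: "gleason_invariant k E" and low: "\<And>j. j \<le> k \<Longrightarrow> coeff E j = 0"
  shows "E = 0"
proof (rule ccontr)
  assume "E \<noteq> 0"
  have deg6: "degree E \<le> 6 * k" using E by (simp add: gleason_invariant_def)
  have "coeff E (degree E) \<noteq> 0" using \<open>E \<noteq> 0\<close> by simp
  \<comment> \<open>The leading coefficient reappears at position \<open>6 * k - degree E\<close>,
    which must lie beyond the vanishing range.\<close>
  then have deg: "degree E < 5 * k"
    using gleason_invariant_reciprocal[OF E deg6] low[of "6 * k - degree E"] deg6 by force
  \<comment> \<open>The right side of the invariance with denominators cleared; only the terms with
    \<open>j > k\<close> survive.\<close>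
  define S where "S = (\<Sum>j\<le>6*k. smult (coeff E j) ([:1, - 1:] ^ (4 * j) * [:1, 1:] ^ (24 * k - 4 * j)))"
  have "smult (4096 ^ k) (pcompose E (monom 1 4)) = S"
  proof (rule poly_eqI_pos)
    fix y :: real assume "y > 0"
    have "poly (smult (4096 ^ k) (pcompose E (monom 1 4))) y =
        (1 + y) ^ (24 * k) * poly E (((1 - y) / (1 + y)) ^ 4)"
      using E \<open>y > 0\<close> by (simp add: gleason_invariant_def poly_pcompose poly_monom)
    also have "\<dots> = (\<Sum>j\<le>6*k. coeff E j * ((1 - y) ^ (4 * j) * (1 + y) ^ (24 * k - 4 * j)))"
      unfolding poly_altdef_le[OF deg6] sum_distrib_left
      using \<open>y > 0\<close> by (intro sum.cong) (auto simp: power_diff power_divide power_mult[symmetric])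
    also have "\<dots> = poly S y" by (simp add: S_def poly_sum)
    finally show "poly (smult (4096 ^ k) (pcompose E (monom 1 4))) y = poly S y" .
  qed
  moreover have "[:- 1, 1:] ^ (4 * k + 4) dvd S"
    unfolding S_def
  proof (intro dvd_sum)
    fix j
    show "[:- 1, 1:] ^ (4 * k + 4) dvd smult (coeff E j) ([:1, - 1:] ^ (4 * j) * [:1, 1:] ^ (24 * k - 4 * j))"
    proof (cases "j \<le> k")
      case False
      have "[:1, - 1:] ^ (4 * j) = ([:- 1, 1:] ^ (4 * j) :: real poly)"
        using power_minus_even[of "4 * j" "[:- 1, 1:] :: real poly"] by simp
      then have "[:- 1, 1:] ^ (4 * k + 4) dvd ([:1, - 1:] ^ (4 * j) :: real poly)"
        using False by (simp only:) (rule le_imp_power_dvd, simp)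
      then show ?thesis by (intro dvd_smult dvd_mult2)
    qed (simp add: low)
  qed
  ultimately have "[:- 1, 1:] ^ (4 * k + 4) dvd pcompose E (monom 1 4)"
    by (metis dvd_smult_cancel power_not_zero zero_neq_numeral)
  moreover have "pcompose E (monom 1 4) \<noteq> 0"
    using \<open>E \<noteq> 0\<close> by (simp add: pcompose_eq_0_iff degree_monom_eq)
  ultimately have ord: "4 * k + 4 \<le> order 1 E"
    using order_pcompose_monom[OF \<open>E \<noteq> 0\<close>, of 4] by (simp add: order_divides)
  have "monom 1 (k + 1) dvd E" using low by (simp add: monom_1_dvd_iff')
  then obtain H where H: "E = monom 1 (k + 1) * H" by (elim dvdE)
  then have "H \<noteq> 0" using \<open>E \<noteq> 0\<close> by auto
  have "order 1 (monom 1 (k + 1) :: real poly) = 0" by (rule order_0I) (simp add: poly_monom)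
  then have "order 1 E = order 1 H" using \<open>E \<noteq> 0\<close> unfolding H by (subst order_mult) auto
  also have "\<dots> \<le> degree H" by (rule order_degree[OF \<open>H \<noteq> 0\<close>])
  also have "degree H + (k + 1) = degree E"
    unfolding H using \<open>H \<noteq> 0\<close> by (subst degree_mult_eq) (auto simp: degree_monom_eq)
  finally show False using ord deg by linarith
qed

text \<open>Triangular elimination: the next multiplier is the first remaining coefficient, and
  subtracting \<open>B n\<close> leaves the coefficients below \<open>n\<close> untouched.\<close>

lemma unitriangular_interpolation:
  fixes B :: "nat \<Rightarrow> 'a::comm_ring_1 poly"
  assumes "\<And>r j. j < r \<Longrightarrow> coeff (B r) j = 0" "\<And>r. r < n \<Longrightarrow> coeff (B r) r = 1"
  shows "\<exists>a. \<forall>j<n. coeff (q - (\<Sum>r<n. smult (a r) (B r))) j = 0"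
  using assms(2)
proof (induction n)
  case (Suc n)
  then obtain a where a: "\<And>j. j < n \<Longrightarrow> coeff (q - (\<Sum>r<n. smult (a r) (B r))) j = 0"
    by auto
  define b where "b = a(n := coeff (q - (\<Sum>r<n. smult (a r) (B r))) n)"
  have b: "(\<Sum>r<Suc n. smult (b r) (B r)) = (\<Sum>r<n. smult (a r) (B r)) + smult (b n) (B n)"
    by (simp add: b_def)
  have "coeff (q - (\<Sum>r<Suc n. smult (b r) (B r))) j = 0" if "j < Suc n" for j
  proof (cases "j = n")
    case True
    then show ?thesis unfolding b using Suc.prems[of n] by (simp add: b_def)
  next
    case False
    then show ?thesis unfolding b using a[of j] assms(1)[of j n] that by simp
  qed
  then show ?case by blast
qed simp

text \<open>The MacWilliams identity of the extended Hamming code, which has 16 words; multiplying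
  by \<open>(1 + y) ^ 8\<close> clears all denominators.\<close>

lemma poly_gleason_f_transform:
  "y \<noteq> - 1 \<Longrightarrow> (1 + y) ^ 8 * poly gleason_f (((1 - y) / (1 + y)) ^ 4) = 16 * poly gleason_f (y ^ 4)"
proof -
  assume y: "y \<noteq> - 1"
  define z where "z = ((1 - y) / (1 + y)) ^ 4"
  have z: "(1 + y) ^ 4 * z = (1 - y) ^ 4"
    using y by (simp add: z_def power_divide)
  have "(1 + y) ^ 8 * poly gleason_f z =
      ((1 + y) ^ 4)\<^sup>2 + 14 * (1 + y) ^ 4 * ((1 + y) ^ 4 * z) + ((1 + y) ^ 4 * z)\<^sup>2"
    by (simp add: gleason_f_def algebra_simps power2_eq_square flip: power_mult power_add)
  also have "\<dots> = 16 * poly gleason_f (y ^ 4)"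
    unfolding z gleason_f_def by simp algebra
  finally show ?thesis unfolding z_def .
qed

text \<open>The form is the fourth power of \<open>x y (x^4 - y^4)\<close>, which the substitution
  of \<open>x + y\<close>, \<open>x - y\<close> multiplies by 8; and
  \<open>8 ^ 4 = 4096\<close>.\<close>

lemma poly_gleason_g_transform:
  "y \<noteq> - 1 \<Longrightarrow> (1 + y) ^ 24 * poly gleason_g (((1 - y) / (1 + y)) ^ 4) = 4096 * poly gleason_g (y ^ 4)"
proof -
  assume y: "y \<noteq> - 1"
  define z where "z = ((1 - y) / (1 + y)) ^ 4"
  have z: "(1 + y) ^ 4 * z = (1 - y) ^ 4"
    using y by (simp add: z_def power_divide)
  have "(1 + y) ^ 24 * poly gleason_g z =
      (1 + y) ^ 4 * ((1 + y) ^ 4 * z) * ((1 + y) ^ 4 - (1 + y) ^ 4 * z) ^ 4"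
    unfolding gleason_g_def by simp algebra
  also have "\<dots> = ((1 + y) * (1 - y) * ((1 + y) ^ 4 - (1 - y) ^ 4)) ^ 4"
    unfolding z by (simp only: power_mult_distrib mult.assoc)
  also have "(1 + y) * (1 - y) * ((1 + y) ^ 4 - (1 - y) ^ 4) = 8 * y * (1 - y ^ 4)"
    by algebra
  also have "(8 * y * (1 - y ^ 4)) ^ 4 = 4096 * poly gleason_g (y ^ 4)"
    by (simp add: gleason_g_def power_mult_distrib)
  finally show ?thesis unfolding z_def .
qed

text \<open>The transformation laws multiply: lengths add up to
  \<open>8 * 3 * (k - r) + 24 * r = 24 * k\<close>, and the scalars match as
  \<open>16 ^ 3 = 4096\<close>.\<close>

lemma gleason_invariant_basis:
  assumes "r \<le> k"
  shows "gleason_invariant k (gleason_f ^ (3 * (k - r)) * gleason_g ^ r)"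
proof -
  have "degree gleason_f = 2" "degree gleason_g = 5"
    by (simp_all add: gleason_f_def gleason_g_def degree_mult_eq degree_power_eq)
  then have "degree (gleason_f ^ (3 * (k - r)) * gleason_g ^ r) \<le> 3 * (k - r) * 2 + r * 5"
    by (intro order_trans[OF degree_mult_le] add_mono order_trans[OF degree_power_le]) auto
  also have "\<dots> \<le> 6 * k" using assms by linarith
  finally have deg: "degree (gleason_f ^ (3 * (k - r)) * gleason_g ^ r) \<le> 6 * k" .
  have "4096 ^ k * poly (gleason_f ^ (3 * (k - r)) * gleason_g ^ r) (y ^ 4) =
      (1 + y) ^ (24 * k) * poly (gleason_f ^ (3 * (k - r)) * gleason_g ^ r) (((1 - y) / (1 + y)) ^ 4)"
    if "y \<noteq> - 1" for y
  proof -
    define z where "z = ((1 - y) / (1 + y)) ^ 4"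
    have "4096 ^ k = (16 :: real) ^ (3 * (k - r)) * 4096 ^ r"
    proof -
      have "(16 :: real) ^ (3 * (k - r)) = 4096 ^ (k - r)" by (simp add: power_mult)
      with assms show ?thesis by (simp flip: power_add)
    qed
    then have "4096 ^ k * poly (gleason_f ^ (3 * (k - r)) * gleason_g ^ r) (y ^ 4) =
        (16 * poly gleason_f (y ^ 4)) ^ (3 * (k - r)) * (4096 * poly gleason_g (y ^ 4)) ^ r"
      by (simp add: power_mult_distrib)
    also have "\<dots> = ((1 + y) ^ 8) ^ (3 * (k - r)) * ((1 + y) ^ 24) ^ r *
        poly (gleason_f ^ (3 * (k - r)) * gleason_g ^ r) z"
      unfolding poly_gleason_f_transform[OF that, symmetric] poly_gleason_g_transform[OF that, symmetric]
        z_def[symmetric] by (simp only: power_mult_distrib poly_mult poly_power mult_ac)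
    also have "((1 + y) ^ 8) ^ (3 * (k - r)) * ((1 + y) ^ 24) ^ r = (1 + y) ^ (24 * k)"
    proof -
      have "8 * (3 * (k - r)) + 24 * r = 24 * k" using assms by simp
      then show ?thesis by (simp only: power_mult[symmetric] power_add[symmetric])
    qed
    finally show ?thesis unfolding z_def .
  qed
  with deg show ?thesis by (simp add: gleason_invariant_def)
qed

text \<open>The basis element with index \<open>r\<close> starts with \<open>z^r\<close>, so some
  combination agrees with \<open>q\<close> up to \<open>z^k\<close>. The difference is invariant and
  vanishes by \<open>gleason_invariant_eq_0\<close>.\<close>

theorem Gleason:
  assumes "gleason_invariant k q"
  obtains a where "q = (\<Sum>r\<le>k. smult (a r) (gleason_f ^ (3 * (k - r)) * gleason_g ^ r))"
proof -
  define B where "B r = gleason_f ^ (3 * (k - r)) * gleason_g ^ r" for r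
  have g: "gleason_g ^ r = monom 1 r * ([:1, - 1:] ^ 4) ^ r" for r
    by (simp add: gleason_g_def power_mult_distrib monom_altdef del: mult_pCons_left)
  have "B r = monom 1 r * (gleason_f ^ (3 * (k - r)) * ([:1, - 1:] ^ 4) ^ r)" for r
    unfolding B_def g by (simp only: mult_ac)
  then have "coeff (B r) j = (if j < r then 0 else coeff (gleason_f ^ (3 * (k - r)) * ([:1, - 1:] ^ 4) ^ r) (j - r))"
    for r j by (simp add: coeff_monom_mult)
  then have "\<And>r j. j < r \<Longrightarrow> coeff (B r) j = 0" "\<And>r. coeff (B r) r = 1"
    by (simp_all add: coeff_mult_0 coeff_0_power gleason_f_def)
  then obtain a where a: "\<And>j. j < Suc k \<Longrightarrow> coeff (q - (\<Sum>r<Suc k. smult (a r) (B r))) j = 0"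
    using unitriangular_interpolation[of B "Suc k" q] by blast
  have "gleason_invariant k (q - (\<Sum>r<Suc k. smult (a r) (B r)))"
    unfolding B_def
    by (intro gleason_invariant_diff gleason_invariant_sum_smult gleason_invariant_basis assms) auto
  from gleason_invariant_eq_0[OF this] a have "q - (\<Sum>r<Suc k. smult (a r) (B r)) = 0" by auto
  then have "q = (\<Sum>r\<le>k. smult (a r) (B r))" by (simp only: lessThan_Suc_atMost right_minus_eq)
  then show ?thesis using that unfolding B_def by blast
qed

subsection \<open>Lagrange inversion\<close>

text \<open>With \<open>\<phi> = g / f^3\<close> one has \<open>\<phi>' = lagrange_h * (1 - z)^3 / f^4\<close>, and
\<open>lagrange_kernel k s / z^(s + 1)\<close> is \<open>f^(-3k) \<phi>^(-s-1) \<phi>'\<close>. Pairing it with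
\<open>f^(3k) \<phi>^r\<close>, \<open>r < s\<close>, leaves the residue of the derivative of a multiple of \<open>\<phi>^(r-s)\<close>,
which is \<open>0\<close>.\<close>

definition lagrange_h :: "real poly" where "lagrange_h = [:1, 1:] * [:1, - 34, 1:]"

definition lagrange_kernel :: "nat \<Rightarrow> nat \<Rightarrow> real fps" where
  "lagrange_kernel k s =
    fps_of_poly (gleason_f ^ (3 * (s - k) - 1) * lagrange_h) * inverse (1 - fps_X) ^ (4 * s + 1)"

lemma lagrange_kernel_nth_zero:
  assumes "s > 0"
  shows "fps_nth (lagrange_kernel 0 s) s = 0"
proof -
  define F :: "real fps" where "F = fps_of_poly gleason_f"
  define G :: "real fps" where "G = fps_of_poly (pderiv gleason_f)"
  define I :: "real fps" where "I = inverse (1 - fps_X)"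
  have I: "(1 - fps_X) * I = 1" unfolding I_def by (rule inverse_mult_eq_1') simp
  have dI: "fps_deriv I = I\<^sup>2"
    unfolding I_def by (subst fps_inverse_deriv) auto
  have dF: "fps_deriv F = G" by (simp add: F_def G_def fps_of_poly_pderiv)
  obtain t where t: "3 * s = Suc t" using assms by (cases "3 * s") auto
  obtain u where u: "4 * s = Suc u" using assms by (cases "4 * s") auto
  \<comment> \<open>This is \<open>(z / \<phi>)^s\<close>. The kernel is
    \<open>\<psi> - z \<psi>' / s\<close>, and at \<open>z^s\<close> differentiation contributes the
    factor \<open>s\<close>, so the two terms cancel.\<close>
  define \<psi> where "\<psi> = F ^ (3 * s) * I ^ (4 * s)"
  have "fps_deriv \<psi> = of_nat (3 * s) * G * F ^ t * I ^ (4 * s) + of_nat (4 * s) * I\<^sup>2 * I ^ u * F ^ (3 * s)"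
    unfolding \<psi>_def fps_deriv_mult fps_deriv_power t u diff_Suc_1 dF dI
    by (simp only: mult_ac add.commute fps_of_nat)
  also have "\<dots> = of_nat s * F ^ t * I ^ (4 * s) * (3 * G + 4 * (I * F))"
    unfolding of_nat_mult of_nat_numeral unfolding t u power_Suc power2_eq_square
    by (simp only: ring_distribs mult_ac)
  finally have d: "fps_deriv \<psi> = of_nat s * F ^ t * I ^ (4 * s) * (3 * G + 4 * (I * F))" .
  \<comment> \<open>The logarithmic derivative of \<open>\<phi>\<close> multiplied by
    \<open>z (1 - z) f\<close>.\<close>
  have H: "fps_of_poly lagrange_h = (1 - fps_X) * F - fps_X * (3 * ((1 - fps_X) * G) + 4 * F)"
  proof -
    have 1: "lagrange_h = [:1, - 1:] * gleason_f -
        [:0, 1:] * (smult 3 ([:1, - 1:] * pderiv gleason_f) + smult 4 gleason_f)"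
      by (simp add: lagrange_h_def gleason_f_def pderiv_pCons)
    have 2: "fps_of_poly [:1, - 1 :: real:] = 1 - fps_X"
      by (simp add: fps_of_poly_linear')
    show ?thesis
      unfolding 1 fps_of_poly_diff fps_of_poly_add fps_of_poly_mult fps_of_poly_smult
        fps_of_poly_fps_X 2 F_def G_def fps_numeral_fps_const by (rule refl)
  qed
  have "of_nat s * \<psi> - fps_X * fps_deriv \<psi> =
      of_nat s * F ^ t * I ^ (4 * s) * (1 * F - fps_X * (3 * (1 * G) + 4 * (I * F)))"
    unfolding d unfolding \<psi>_def t by (simp only: power_Suc ring_distribs mult_ac mult_1_left)
  also have "\<dots> = of_nat s * F ^ t * I ^ (4 * s) * (I * fps_of_poly lagrange_h)"
  proof -
    define D :: "real fps" where "D = 1 - fps_X"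
    have "I * fps_of_poly lagrange_h = (D * I) * F - fps_X * (3 * ((D * I) * G) + 4 * (I * F))"
      unfolding H D_def[symmetric] by (simp only: ring_distribs mult_ac)
    also have "D * I = 1" unfolding D_def by (rule I)
    finally show ?thesis by (simp only:)
  qed
  also have "\<dots> = of_nat s * lagrange_kernel 0 s"
    unfolding lagrange_kernel_def diff_zero t diff_Suc_1
    by (simp only: F_def I_def fps_of_poly_mult fps_of_poly_power mult_ac power_add power_one_right)
  finally have "of_nat s * lagrange_kernel 0 s = of_nat s * \<psi> - fps_X * fps_deriv \<psi>" ..
  then have "fps_nth (of_nat s * lagrange_kernel 0 s) s = fps_nth (of_nat s * \<psi> - fps_X * fps_deriv \<psi>) s"
    by (rule arg_cong)
  also have "\<dots> = 0"
    using assms by (simp add: fps_of_nat[symmetric])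
  finally show ?thesis using assms by (simp add: fps_of_nat[symmetric])
qed

text \<open>The factor \<open>(1 - z)^(4r)\<close> of \<open>g^r\<close> cancels against the kernel
  and the powers of \<open>f\<close> combine. As \<open>k < s\<close>, the truncated difference
  \<open>3 * (s - k) - 1\<close> is a genuine one.\<close>

lemma basis_times_lagrange_kernel:
  assumes "r \<le> k" "k < s"
  shows "fps_of_poly (gleason_f ^ (3 * (k - r)) * gleason_g ^ r) * lagrange_kernel k s =
    fps_X ^ r * lagrange_kernel 0 (s - r)"
proof -
  define I :: "real fps" where "I = inverse (1 - fps_X)"
  have I: "(1 - fps_X) * I = 1" unfolding I_def by (rule inverse_mult_eq_1') simp
  have g: "fps_of_poly gleason_g = fps_X * (1 - fps_X) ^ 4"
    unfolding gleason_g_def by (simp only: fps_of_poly_mult fps_of_poly_power fps_of_poly_fps_X)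
      (simp add: fps_of_poly_linear')
  then have gr: "fps_of_poly gleason_g ^ r = fps_X ^ r * (1 - fps_X) ^ (4 * r)"
    by (simp only: power_mult_distrib power_mult)
  have e: "3 * (s - r) - 1 = 3 * (k - r) + (3 * (s - k) - 1)" "4 * s + 1 = 4 * r + (4 * (s - r) + 1)"
    using assms by auto
  have "fps_of_poly (gleason_f ^ (3 * (k - r)) * gleason_g ^ r) * lagrange_kernel k s =
      fps_X ^ r * ((1 - fps_X) * I) ^ (4 * r) *
      (fps_of_poly gleason_f ^ (3 * (k - r)) * fps_of_poly gleason_f ^ (3 * (s - k) - 1) *
       fps_of_poly lagrange_h * I ^ (4 * (s - r) + 1))"
    unfolding lagrange_kernel_def e(2) I_def[symmetric]
    by (simp only: fps_of_poly_mult fps_of_poly_power gr power_add power_mult_distrib mult_ac)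
  also have "\<dots> = fps_X ^ r * lagrange_kernel 0 (s - r)"
    unfolding I lagrange_kernel_def I_def[symmetric]
    by (simp only: diff_zero e(1) fps_of_poly_mult fps_of_poly_power power_add power_one mult_1_right
        mult.assoc)
  finally show ?thesis .
qed

text \<open>A linear relation among the coefficients of \<open>q\<close> up to index
  \<open>s\<close>. By Gleason's theorem it suffices to check it on the basis, where it reduces to
  \<open>lagrange_kernel_nth_zero\<close>.\<close>

theorem gleason_functional:
  assumes "gleason_invariant k q" "k < s"
  shows "fps_nth (fps_of_poly q * lagrange_kernel k s) s = 0"
proof -
  obtain a where a: "q = (\<Sum>r\<le>k. smult (a r) (gleason_f ^ (3 * (k - r)) * gleason_g ^ r))"
    using Gleason[OF assms(1)] .
  have "fps_of_poly q * lagrange_kernel k s =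
      (\<Sum>r\<le>k. fps_const (a r) * (fps_X ^ r * lagrange_kernel 0 (s - r)))"
    unfolding a fps_of_poly_sum fps_of_poly_smult sum_distrib_right
    using assms(2) by (intro sum.cong) (auto simp: mult.assoc basis_times_lagrange_kernel)
  then show ?thesis
    using assms(2) by (simp add: fps_sum_nth fps_X_power_mult_nth lagrange_kernel_nth_zero)
qed

lemma inverse_one_minus_X_power_nth:
  "fps_nth (inverse (1 - fps_X) ^ Suc n :: real fps) j = real ((n + j) choose n)"
proof -
  have "fps_nth (inverse (1 - fps_X) ^ Suc n :: real fps) j = fps_nth (inverse ((1 - fps_const 1 * fps_X) ^ Suc n)) j"
    by (simp add: fps_inverse_power del: power_Suc)
  also have "\<dots> = real ((n + j) choose j)"
    by (subst one_minus_const_fps_X_neg_power') auto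
  also have "(n + j) choose j = (n + j) choose n"
    by (subst binomial_symmetric) auto
  finally show ?thesis .
qed

lemma poly_mult_negative_binomial_nth:
  "fps_nth (fps_of_poly p * inverse (1 - fps_X) ^ Suc n) s =
    (\<Sum>i\<le>s. coeff p i * real ((n + s - i) choose n))"
  unfolding fps_mult_nth inverse_one_minus_X_power_nth by (simp add: atLeast0AtMost)

subsection \<open>A negative coefficient\<close>

text \<open>The numerator of the kernel for \<open>s = k + 1\<close>; the next lemma treats
  \<open>s = k + 2\<close>.\<close>

lemma gleason_f_power2_lagrange_h:
  "gleason_f\<^sup>2 * lagrange_h = [:1, - 5, - 759, - 7429, - 7429, - 759, - 5, 1:]"
  by (simp add: gleason_f_def lagrange_h_def power2_eq_square)

lemma gleason_f_power5_lagrange_h: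
  "gleason_f ^ 5 * lagrange_h = [:1, 37, - 378, - 39434, - 781565, - 6852681, - 25880412,
     - 25880412, - 6852681, - 781565, - 39434, - 378, 37, 1:]"
  by (simp add: gleason_f_def lagrange_h_def eval_nat_numeral)

lemma poly_pochhammer: "poly (pochhammer p n) x = pochhammer (poly p x) n"
  by (induction n) (simp_all add: pochhammer_Suc)

text \<open>The difference of the two sides is a polynomial of degree \<open>14\<close> whose expansion in powers of
\<open>x - 154\<close> has only negative coefficients.\<close>

lemma pochhammer_sums_less:
  fixes x :: real
  assumes "x \<ge> 154"
  shows "(4 * x + 46) * (pochhammer (4 * x + 5) 4 *
      (\<Sum>i\<le>7. coeff (gleason_f\<^sup>2 * lagrange_h) i *
        (pochhammer (5 * x - 2) (8 - i) * pochhammer (x + 2 - of_nat i) (Suc i)))) <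
    (\<Sum>i\<le>13. coeff (gleason_f ^ 5 * lagrange_h) i *
      (pochhammer (5 * x - 2) (13 - i) * pochhammer (x + 3 - of_nat i) i))"
    (is "?L < ?R")
proof -
  define t where "t = x - 154"
  \<comment> \<open>A polynomial counterpart of \<open>x = t + 154\<close>, so that the expansion
    around 154 becomes a computation with coefficients.\<close>
  define X :: "real poly" where "X = [:154, 1:]"
  define P where "P = (4 * X + 46) * (pochhammer (4 * X + 5) 4 *
      (\<Sum>i\<le>7. smult (coeff (gleason_f\<^sup>2 * lagrange_h) i)
        (pochhammer (5 * X - 2) (8 - i) * pochhammer (X + 2 - of_nat i) (Suc i)))) -
    (\<Sum>i\<le>13. smult (coeff (gleason_f ^ 5 * lagrange_h) i)
      (pochhammer (5 * X - 2) (13 - i) * pochhammer (X + 3 - of_nat i) i))"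
  have "poly X t = x" by (simp add: X_def t_def)
  then have "?L - ?R = poly P t"
    unfolding P_def by (simp only: poly_diff poly_mult poly_add poly_sum poly_smult poly_pochhammer
        poly_numeral poly_of_nat)
  also have "P = - [:359484594830496461821532533022951424000, 1155051412222004192705253851436277248000,
      96076319690959010423627263890538475520, 3723419448164188682891188295288011776,
      88394243292741328895307288504683520, 1432156533027379753246043453328384,
      16714663180663294412631939732480, 144540599208369515482303531008,
      937599696619392329964933120, 4562003049865634823708672, 16443498208544091832320,
      42676632053848866816, 75521928957788160, 81675203641344, 40768634880:]"
    unfolding P_def X_def gleason_f_power2_lagrange_h gleason_f_power5_lagrange_h
    by (simp add: numeral_eq_Suc pochhammer_Suc numeral_poly one_pCons of_nat_poly)
  also have "poly \<dots> t < 0"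
    using assms unfolding poly_minus neg_less_0_iff_less poly_pCons poly_0 t_def
    by (intro add_pos_nonneg add_nonneg_nonneg mult_nonneg_nonneg) simp_all
  finally show ?thesis by simp
qed

section \<open>Sign of the coefficient with index \<open>k + 2\<close>\<close>

lemma fact_add_pochhammer: "fact (n + m) = fact n * pochhammer (of_nat n + 1 :: 'a::{semiring_char_0,comm_semiring_1}) m"
  by (induction m) (simp_all add: pochhammer_Suc algebra_simps)

text \<open>Brings binomials with varying top entry to one denominator and splits off a common
  factorial \<open>fact a\<close>; what remains is polynomial.\<close>

lemma binomial_pochhammer:
  assumes "n - m = l" "m \<le> n" "n = a + b" "l + c = d"
  shows "real (n choose m) * (fact m * fact d) =
    fact a * (pochhammer (real a + 1) b * pochhammer (real l + 1) c)"
proof -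
  have "real (n choose m) * (fact m * fact d) = fact n * pochhammer (real l + 1) c"
    unfolding binomial_fact[OF assms(2)] assms(1) assms(4)[symmetric] fact_add_pochhammer
    by simp
  then show ?thesis unfolding assms(3) fact_add_pochhammer by simp
qed

lemma sum_mult_proportional:
  fixes b :: "'b \<Rightarrow> 'a::comm_semiring_0"
  assumes "\<And>i. i \<in> I \<Longrightarrow> b i * c = d * e i"
  shows "(\<Sum>i\<in>I. a i * b i) * c = d * (\<Sum>i\<in>I. a i * e i)"
proof -
  have "(\<Sum>i\<in>I. a i * b i) * c = (\<Sum>i\<in>I. a i * (b i * c))"
    by (simp only: sum_distrib_right mult.assoc)
  also have "\<dots> = (\<Sum>i\<in>I. a i * (d * e i))"
    by (rule sum.cong) (simp_all add: assms)
  finally show ?thesis by (simp only: sum_distrib_left mult.left_commute)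
qed

text \<open>Because of the gap, the relations for \<open>s = k + 1\<close> and
  \<open>s = k + 2\<close> involve only the coefficients at \<open>0\<close>, \<open>k + 1\<close>
  and \<open>k + 2\<close>. Eliminating the middle one gives
  \<open>(4k + 46) * ?K1 (k + 1) - ?K2 (k + 2)\<close>.\<close>

theorem gleason_invariant_coeff_neg:
  assumes q: "gleason_invariant k q" and q0: "coeff q 0 = 1"
    and gap: "\<And>j. 0 < j \<Longrightarrow> j \<le> k \<Longrightarrow> coeff q j = 0" and k: "k \<ge> 154"
  shows "coeff q (k + 2) < 0"
proof -
  let ?K1 = "fps_nth (lagrange_kernel k (k + 1))" and ?K2 = "fps_nth (lagrange_kernel k (k + 2))"
  let ?p1 = "gleason_f\<^sup>2 * lagrange_h" and ?p2 = "gleason_f ^ 5 * lagrange_h"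
  have K1: "?K1 s = (\<Sum>i\<le>s. coeff ?p1 i * real ((4 * k + 4 + s - i) choose (4 * k + 4)))" for s
  proof -
    have "lagrange_kernel k (k + 1) = fps_of_poly ?p1 * inverse (1 - fps_X) ^ Suc (4 * k + 4)"
      by (simp add: lagrange_kernel_def)
    then show ?thesis by (simp only: poly_mult_negative_binomial_nth)
  qed
  have K2: "?K2 s = (\<Sum>i\<le>s. coeff ?p2 i * real ((4 * k + 8 + s - i) choose (4 * k + 8)))" for s
  proof -
    have "lagrange_kernel k (k + 2) = fps_of_poly ?p2 * inverse (1 - fps_X) ^ Suc (4 * k + 8)"
      by (simp add: lagrange_kernel_def)
    then show ?thesis by (simp only: poly_mult_negative_binomial_nth)
  qed
  have p1: "coeff ?p1 0 = 1" and p2: "coeff ?p2 0 = 1" "coeff ?p2 1 = 37"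
    unfolding gleason_f_power2_lagrange_h gleason_f_power5_lagrange_h by simp_all
  \<comment> \<open>Here \<open>4k + 46\<close> is \<open>(4k + 9) + 37\<close>, from the first two
    numerator coefficients.\<close>
  have low: "?K1 0 = 1" "?K2 0 = 1" "?K2 1 = 4 * real k + 46"
    unfolding K1 K2 using p1 p2 binomial_Suc_n[of "4 * k + 8"] binomial_n_n[of "4 * k + 8"]
    by (simp_all add: add.commute)
  have sum_gap: "(\<Sum>j\<le>k + m. coeff q j * h j) = h 0 + (\<Sum>j\<in>{k<..k + m}. coeff q j * h j)"
    for m and h :: "nat \<Rightarrow> real"
  proof -
    have "{..k + m} = insert 0 {0<..k} \<union> {k<..k + m}" by auto
    moreover have "(\<Sum>j\<in>insert 0 {0<..k} \<union> {k<..k + m}. coeff q j * h j) =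
        (\<Sum>j\<in>insert 0 {0<..k}. coeff q j * h j) + (\<Sum>j\<in>{k<..k + m}. coeff q j * h j)"
      by (rule sum.union_disjoint) auto
    ultimately show ?thesis using q0 gap by simp
  qed
  have "(\<Sum>j\<le>k + 1. coeff q j * ?K1 (k + 1 - j)) = 0"
    using gleason_functional[OF q, of "k + 1"] by (simp add: fps_mult_nth atLeast0AtMost)
  moreover have "{k<..k + 1} = {k + 1}" by auto
  ultimately have eq1: "?K1 (k + 1) + coeff q (k + 1) = 0"
    unfolding sum_gap using low(1) by simp
  have "(\<Sum>j\<le>k + 2. coeff q j * ?K2 (k + 2 - j)) = 0"
    using gleason_functional[OF q, of "k + 2"] by (simp add: fps_mult_nth atLeast0AtMost)
  moreover have "{k<..k + 2} = {k + 1, k + 2}" by auto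
  ultimately have eq2: "?K2 (k + 2) + (coeff q (k + 1) * (4 * real k + 46) + coeff q (k + 2)) = 0"
    unfolding sum_gap using low(2,3) by simp
  \<comment> \<open>A common denominator of all binomials in both sums. The common numerator factor
    is \<open>fact (5 * k - 3)\<close>, the smallest top entry being
    \<open>5 * k + 10 - 13\<close>.\<close>
  define c :: real where "c = fact (4 * k + 8) * fact (k + 2)"
  let ?x = "real k"
  have "?K1 (k + 1) * c = fact (5 * k - 3) * (pochhammer (4 * ?x + 5) 4 *
      (\<Sum>i\<le>7. coeff ?p1 i * (pochhammer (5 * ?x - 2) (8 - i) * pochhammer (?x + 2 - of_nat i) (Suc i))))"
  proof -
    have eq: "?K1 (k + 1) = (\<Sum>i\<le>7. coeff ?p1 i * real ((5 * k + 5 - i) choose (4 * k + 4)))"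
      unfolding K1 gleason_f_power2_lagrange_h
      by (rule sum.mono_neutral_cong_right)
        (use k in \<open>auto simp: coeff_eq_0 algebra_simps\<close>)
    have binom: "real ((5 * k + 5 - i) choose (4 * k + 4)) * c = fact (5 * k - 3) *
        (pochhammer (4 * ?x + 5) 4 * (pochhammer (5 * ?x - 2) (8 - i) * pochhammer (?x + 2 - of_nat i) (Suc i)))"
      if "i \<le> 7" for i
    proof -
      have e1: "real ((5 * k + 5 - i) choose (4 * k + 4)) * (fact (4 * k + 4) * fact (k + 2)) =
          fact (5 * k - 3) * (pochhammer (real (5 * k - 3) + 1) (8 - i) * pochhammer (real (k + 1 - i) + 1) (Suc i))"
        by (rule binomial_pochhammer) (use k that in auto)
      have e2: "fact (4 * k + 8) = fact (4 * k + 4) * pochhammer (4 * ?x + 5) 4"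
        using fact_add_pochhammer[of "4 * k + 4" 4, where 'a = real] by (simp add: add.commute)
      have e3: "real (5 * k - 3) + 1 = 5 * ?x - 2" "real (k + 1 - i) + 1 = ?x + 2 - of_nat i"
        using k that by (simp_all add: of_nat_diff)
      show ?thesis
        using arg_cong[OF e1[unfolded e3], of "\<lambda>z. pochhammer (4 * ?x + 5) 4 * z"]
        unfolding c_def e2 by (simp only: mult_ac)
    qed
    have "?K1 (k + 1) * c = fact (5 * k - 3) * (\<Sum>i\<le>7. coeff ?p1 i *
        (pochhammer (4 * ?x + 5) 4 * (pochhammer (5 * ?x - 2) (8 - i) * pochhammer (?x + 2 - of_nat i) (Suc i))))"
      unfolding eq by (rule sum_mult_proportional) (use binom in simp)
    then show ?thesis by (simp only: sum_distrib_left mult.left_commute)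
  qed
  moreover have "?K2 (k + 2) * c = fact (5 * k - 3) *
      (\<Sum>i\<le>13. coeff ?p2 i * (pochhammer (5 * ?x - 2) (13 - i) * pochhammer (?x + 3 - of_nat i) i))"
  proof -
    have eq: "?K2 (k + 2) = (\<Sum>i\<le>13. coeff ?p2 i * real ((5 * k + 10 - i) choose (4 * k + 8)))"
      unfolding K2 gleason_f_power5_lagrange_h
      by (rule sum.mono_neutral_cong_right)
        (use k in \<open>auto simp: coeff_eq_0 algebra_simps\<close>)
    have binom: "real ((5 * k + 10 - i) choose (4 * k + 8)) * c = fact (5 * k - 3) *
        (pochhammer (5 * ?x - 2) (13 - i) * pochhammer (?x + 3 - of_nat i) i)"
      if "i \<le> 13" for i
    proof -
      have "real ((5 * k + 10 - i) choose (4 * k + 8)) * (fact (4 * k + 8) * fact (k + 2)) =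
          fact (5 * k - 3) * (pochhammer (real (5 * k - 3) + 1) (13 - i) * pochhammer (real (k + 2 - i) + 1) i)"
        by (rule binomial_pochhammer) (use k that in auto)
      moreover have "real (5 * k - 3) + 1 = 5 * ?x - 2" "real (k + 2 - i) + 1 = ?x + 3 - of_nat i"
        using k that by (simp_all add: of_nat_diff)
      ultimately show ?thesis unfolding c_def by (simp only:)
    qed
    show ?thesis unfolding eq by (rule sum_mult_proportional) (use binom in simp)
  qed
  moreover have "154 \<le> ?x" using k by simp
  ultimately have "(4 * ?x + 46) * (?K1 (k + 1) * c) < ?K2 (k + 2) * c"
    using mult_strict_left_mono[OF pochhammer_sums_less[of ?x], of "fact (5 * k - 3)"]
    by (simp only: mult.left_commute fact_gt_zero)
  then have "((4 * ?x + 46) * ?K1 (k + 1)) * c < ?K2 (k + 2) * c" by (simp only: mult.assoc)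
  moreover have "c > 0" by (simp add: c_def)
  ultimately have "(4 * ?x + 46) * ?K1 (k + 1) < ?K2 (k + 2)" by simp
  moreover have "coeff q (k + 1) = - ?K1 (k + 1)" using eq1 by simp
  ultimately show ?thesis using eq2 by (simp add: mult.commute)
qed

subsection \<open>Codes over the integers modulo 4\<close>

text \<open>The coefficient of \<open>q\<close> at \<open>j\<close> counts the words of weight
  \<open>4 * j\<close>. Without small words \<open>q\<close> has the gap that makes the coefficient
  at \<open>k + 2\<close> negative, which is absurd for a count.\<close>

theorem doubly_even_self_dual_min_weight:
  fixes D :: "'n::finite set set"
  assumes D: "binary_code D" "doubly_even D" "binary_dual D = D" "card D = 4096 ^ k"
    and n: "CARD('n) = 24 * k" and k: "k \<ge> 154"
  shows "\<exists>A\<in>D. A \<noteq> {} \<and> card A \<le> 4 * k"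
proof (rule ccontr)
  assume "\<not> ?thesis"
  then have min: "\<And>A. A \<in> D \<Longrightarrow> A \<noteq> {} \<Longrightarrow> card A > 4 * k" by force
  define q :: "real poly" where "q = (\<Sum>A\<in>D. monom 1 (card A div 4))"
  have coeff: "coeff q j = real (card {A \<in> D. card A div 4 = j})" for j
    by (simp add: q_def coeff_sum sum.If_cases Int_def)
  have le: "card A \<le> 24 * k" for A :: "'n set"
    using card_mono[of UNIV A] n by simp
  have four: "4 * (card A div 4) = card A" if "A \<in> D" for A
    using D(2) that by (auto simp: doubly_even_def)
  have val: "poly q (z ^ 4) = (\<Sum>A\<in>D. z ^ card A)" for z
    by (simp add: q_def poly_sum poly_monom four flip: power_mult)
  have "degree q \<le> 6 * k"
    unfolding q_def
  proof (intro degree_sum_le)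
    fix A :: "'n set"
    show "degree (monom (1 :: real) (card A div 4)) \<le> 6 * k"
      using le[of A] by (simp add: degree_monom_eq)
  qed simp
  moreover have "4096 ^ k * poly q (y ^ 4) = (1 + y) ^ (24 * k) * poly q (((1 - y) / (1 + y)) ^ 4)"
    if "y \<noteq> - 1" for y
  proof -
    have "1 + y \<noteq> 0" using that by (simp add: add_eq_0_iff)
    then have "(1 - y) ^ card A * (1 + y) ^ (24 * k - card A) =
        (1 + y) ^ (24 * k) * ((1 - y) / (1 + y)) ^ card A" for A :: "'n set"
      using le[of A] by (simp add: power_diff power_divide)
    then show ?thesis
      using MacWilliams[OF D(1), of y] unfolding val D(3,4) n by (simp add: sum_distrib_left)
  qed
  ultimately have "gleason_invariant k q" by (simp add: gleason_invariant_def)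
  moreover have "coeff q 0 = 1"
  proof -
    have "{} \<in> D" using D(1) by (simp add: binary_code_def)
    then have "{A \<in> D. card A div 4 = 0} = {{}}"
      using four min by (force simp: card_eq_0_iff)
    then show ?thesis unfolding coeff by simp
  qed
  moreover have "coeff q j = 0" if "0 < j" "j \<le> k" for j
  proof -
    have "card A div 4 \<noteq> j" if "A \<in> D" for A
      using min[of A] four[of A] \<open>A \<in> D\<close> \<open>0 < j\<close> \<open>j \<le> k\<close> by (cases "A = {}") auto
    then have "{A \<in> D. card A div 4 = j} = {}" by blast
    then show ?thesis unfolding coeff by simp
  qed
  ultimately have "coeff q (k + 2) < 0" using k by (intro gleason_invariant_coeff_neg)
  then show False unfolding coeff by simp
qed

section \<open>Residue codes and doubled binary words\<close>

lemma z4_cases: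
  obtains "x = 0" | "x = 1" | "x = 2" | "x = (3 :: z4)"
proof (cases x)
  case (of_int z)
  then have "z = 0 \<or> z = 1 \<or> z = 2 \<or> z = 3" by auto
  then show ?thesis using of_int that by auto
qed

lemma of_nat_z4_eq_0_iff: "of_nat m = (0 :: z4) \<longleftrightarrow> 4 dvd m"
  by (simp add: of_nat_eq_0_iff_char_dvd)

text \<open>The support of the reduction modulo 2; its image of a code is the residue code.\<close>

definition odd_support :: "z4 ^ 'n \<Rightarrow> 'n set" where
  "odd_support x = {j. x $ j = 1 \<or> x $ j = 3}"

lemma odd_support_add: "odd_support (x + y) = sym_diff (odd_support x) (odd_support y)"
proof -
  have "(a + b = 1 \<or> a + b = 3) \<longleftrightarrow> (a = 1 \<or> a = 3) \<noteq> (b = 1 \<or> b = 3)" for a b :: z4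
    by (cases a rule: z4_cases; cases b rule: z4_cases) simp_all
  then show ?thesis by (auto simp: odd_support_def)
qed

text \<open>Modulo 4 odd squares are 1 and even squares are 0. Hence self-orthogonal words have odd
  supports of size divisible by 4.\<close>

lemma scalar_product_self_z4: "scalar_product x x = (of_nat (card (odd_support x)) :: z4)"
proof -
  have "a * a = (if a = 1 \<or> a = 3 then 1 else 0)" for a :: z4
    by (cases a rule: z4_cases) simp_all
  then show ?thesis by (simp add: scalar_product_def odd_support_def sum.If_cases)
qed

definition double_word :: "'n set \<Rightarrow> z4 ^ 'n" where
  "double_word X = (\<chi> j. if j \<in> X then 2 else 0)"

text \<open>The product \<open>2 * a\<close> modulo 4 depends only on the parity of
  \<open>a\<close>, which turns orthogonality over \<open>z4\<close> into binary
  orthogonality.\<close>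

lemma scalar_product_double_word_eq_0_iff:
  "scalar_product (double_word X) x = 0 \<longleftrightarrow> even (card (odd_support x \<inter> X))"
proof -
  have "2 * a = (if a = 1 \<or> a = 3 then 2 else 0)" for a :: z4
    by (cases a rule: z4_cases) simp_all
  moreover define S where "S = odd_support x \<inter> X"
  ultimately have "scalar_product (double_word X) x = (\<Sum>j\<in>UNIV. if j \<in> S then 2 else 0)"
    unfolding scalar_product_def by (intro sum.cong) (auto simp: double_word_def odd_support_def)
  also have "\<dots> = of_nat (2 * card S)"
    by (simp add: sum.If_cases mult.commute)
  also have "\<dots> = 0 \<longleftrightarrow> even (card S)"
    unfolding of_nat_z4_eq_0_iff by presburger
  finally show ?thesis unfolding S_def .
qed

lemma lee_weight_double_word: "lee_weight (double_word X) = 2 * card X"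
proof -
  have "comp_count 1 (double_word X) = 0" "comp_count 3 (double_word X) = 0"
    by (simp_all add: comp_count_def double_word_def)
  moreover have "comp_count 2 (double_word X) = card X"
    by (simp add: comp_count_def double_word_def)
  ultimately show ?thesis by (simp add: lee_weight_def)
qed

theorem corollary3p4:
  fixes k :: nat and C :: "(z4 ^ 'n) set"
  assumes "k \<ge> 154"
    and "CARD('n) = 24 * k"
    and "z4_self_dual C"
  shows "min_lee_weight C \<le> 8 * k"
proof -
  interpret module "(*s) :: z4 \<Rightarrow> z4 ^ 'n \<Rightarrow> z4 ^ 'n" by (rule module_z4_vec)
  have C: "subspace C" "C = z4_dual C"
    using assms(3) by (auto simp: z4_self_dual_def z4_code_def)
  define B where "B = odd_support ` C"
  have "binary_code B"
  proof (rule binary_codeI)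
    have "odd_support (0 :: z4 ^ 'n) = {}" by (simp add: odd_support_def)
    then show "{} \<in> B" using subspace_0[OF C(1)] by (force simp: B_def)
    show "sym_diff X Y \<in> B" if "X \<in> B" "Y \<in> B" for X Y
      using that subspace_add[OF C(1)] by (auto simp: B_def odd_support_add[symmetric] simp del: Un_iff)
  qed
  moreover have "doubly_even B"
  proof -
    have "scalar_product x x = 0" if "x \<in> C" for x
      using C(2) that by (auto simp: z4_dual_def)
    then show ?thesis
      by (auto simp: doubly_even_def B_def scalar_product_self_z4 of_nat_z4_eq_0_iff)
  qed
  ultimately obtain D where D: "B \<subseteq> D" "binary_code D" "doubly_even D" "binary_dual D = D"
    and "card D = 16 ^ (3 * k)"
    by (rule doubly_even_extension[of B "3 * k"]) (use assms(2) in auto)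
  then have "card D = 4096 ^ k" by (simp add: power_mult)
  with D assms obtain A where A: "A \<in> D" "A \<noteq> {}" "card A \<le> 4 * k"
    using doubly_even_self_dual_min_weight by blast
  \<comment> \<open>Enlarging \<open>B\<close> to \<open>D\<close> shrinks the dual, so
    \<open>D\<close>, being its own dual, lies in the dual of \<open>B\<close>.\<close>
  have "A \<in> binary_dual B" using binary_dual_antimono[OF D(1)] D(4) A(1) by auto
  then have "double_word A \<in> z4_dual C"
    by (auto simp: z4_dual_def scalar_product_double_word_eq_0_iff binary_dual_def B_def)
  then have "double_word A \<in> C" using C(2) by simp
  moreover have "double_word A \<noteq> 0"
    using A(2) by (auto simp: double_word_def vec_eq_iff)
  ultimately have "min_lee_weight C \<le> lee_weight (double_word A)"
    unfolding min_lee_weight_def by (intro Min_le) auto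
  with A(3) show ?thesis by (simp add: lee_weight_double_word)
qed

end
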